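(* Let $\mathbf{r}=(r_1,\dots,r_N)\in\mathbb{Z}_{++}^N$ be a fixed consumption vector (all $r_i\ge1$) and let $\mathcal F_{\mathbf r}=\{\mathbf{x}\in\mathbb{Z}_+^N:x_i\ge r_i\text{ for every }i\}$. Consider any finite $\mathbf r$-balanced instance, and suppose $f_{\mathbf r}:\mathcal F_{\mathbf r}\to\mathbb{R}_+$ is positive, finite, and componentwise non-increasing on $\mathcal F_{\mathbf r}$. Then for any $\alpha>0$, the fixed-consumption policy $CB_\alpha(\mathbf r)$ satisfies $$J^{CB_\alpha(\mathbf r)}\le\left(1+\max\left\{\alpha,\tfrac1\alpha\right\}\right)J^{OPT(\mathbf r)}.$$ In particular, $J^{CB_1(\mathbf r)}\le 2J^{OPT(\mathbf r)}$. Moreover, the factor $2$ is tight over the class of positive, componentwise non-increasing fixed-consumption matching-cost functions: for every $\eta>0$ and every deterministic online policy $\pi$, there exist a positive, finite, componentwise non-increasing $f_{\mathbf r}$ on $\mathcal F_{\mathbf r}$ and a finite $\mathbf r$-balanced arrival sequence with $J^\pi/J^{OPT(\mathbf r)}\ge 2-\eta$.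
   Context: **Model.** There are $N\ge2$ agent types with waiting-cost rates $c_1,\dots,c_N>0$. Agents of each type arrive over continuous time $t\ge0$ (arbitrary arrival times, finitely many in any finite interval). The state $\mathbf{X}(t)\in\mathbb{Z}_+^N$ records the number of unmatched agents of each type; the system starts empty. A type-$i$ arrival changes the state by $\mathbf{X}\leftarrow\mathbf{X}+\mathbf{e}_i$. A match consumes $r_i$ agents of each type $i$: it is feasible iff $\mathbf{X}\in\mathcal F_{\mathbf r}$, and changes the state by $\mathbf{X}\leftarrow\mathbf{X}-\mathbf{r}$. A policy may execute matches at any calendar times (several matches at one time are allowed). Events are processed one at a time; simultaneous arrivals are processed in an arbitrary but fixed order and a policy may re-evaluate its decision after each individual arrival. A deterministic online policy knows the model primitives ($N$, $c_i$, $\mathbf r$, $f_{\mathbf r}$), and its decisions at any time are a deterministic function of the arrivals and matches so far (and of elapsed time); it has no knowledge of future arrivals, including whether any remain. **Costs.** The waiting-cost rate in state $\mathbf{x}$ is $w(\mathbf{x})=\sum_i c_ix_i$. The $k$-th match of policy $\pi$, executed at time $\tau_k^\pi$, costs $f_{\mathbf r}(\mathbf{Y}_k^\pi)$, where $\mathbf{Y}_k^\pi$ is the pre-match state. Componentwise non-increasing means $f_{\mathbf r}(\mathbf{x})\le f_{\mathbf r}(\mathbf{y})$ whenever $\mathbf{x},\mathbf{y}\in\mathcal F_{\mathbf r}$, $\mathbf{x}\succeq\mathbf{y}$. **Finite $\mathbf r$-balanced instance.** For some integer $K$, the finite arrival sequence contains exactly $Kr_i$ arrivals of type $i$ for every $i$.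 A policy that fails to execute all $K$ matches has cost $+\infty$; otherwise $J^\pi=\int_0^{\tau_K^\pi}w(\mathbf{X}^\pi(t))\,dt+\sum_{k=1}^K f_{\mathbf r}(\mathbf{Y}_k^\pi)$. $J^{OPT(\mathbf r)}$ is the minimum total cost over offline policies knowing the whole arrival sequence in advance. **The policy $CB_\alpha(\mathbf r)$ ($\alpha>0$).** Let $W$ denote the waiting cost $\int w(\mathbf{X}(s))\,ds$ accumulated since the previous match (since time $0$ before the first match); $W$ is reset to $0$ after each match. In current state $\mathbf{x}$: if $\mathbf{x}\notin\mathcal F_{\mathbf r}$, wait for the next arrival (while $W$ keeps accumulating) and process it; if $\mathbf{x}\in\mathcal F_{\mathbf r}$ and $f_{\mathbf r}(\mathbf{x})\le\alpha W$, execute one match immediately and reset $W$; if $\mathbf{x}\in\mathcal F_{\mathbf r}$ and $f_{\mathbf r}(\mathbf{x})>\alpha W$, set a timer of length $(f_{\mathbf r}(\mathbf{x})/\alpha-W)/w(\mathbf{x})$; if the timer expires before the next arrival, execute one match and reset $W$; otherwise discard the timer, process the arrival, and re-evaluate. If a timer and an arrival occur at the same calendar time, the timer is processed first. The procedure repeats until no arrivals remain and $\mathbf{x}\notin\mathcal F_{\mathbf r}$. *)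

theory Defs
  imports "HOL-Analysis.Analysis"
begin

text \<open>
  Agent types are the elements of a finite type; a state assigns to each agent type its number of
  unmatched agents. An arrival sequence is a list in processing order, so simultaneous arrivals
  are processed in the order in which they are listed.
\<close>

type_synonym 'n state = "'n \<Rightarrow> nat"
type_synonym 'n arrivals = "(real \<times> 'n) list"

datatype 'n event = Arrival 'n | Match

type_synonym 'n history = "(real \<times> 'n event) list"

definition feasible_states :: "'n state \<Rightarrow> 'n state set" where
  "feasible_states r = {x. \<forall>i. r i \<le> x i}"

definition matching_cost :: "'n state \<Rightarrow> ('n state \<Rightarrow> real) \<Rightarrow> bool" where
  "matching_cost r f \<longleftrightarrow>
     (\<forall>x\<in>feasible_states r. 0 < f x) \<and>
     antimono_on (feasible_states r) f"

definition balanced :: "'n state \<Rightarrow> nat \<Rightarrow> 'n arrivals \<Rightarrow> bool" where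
  "balanced r K arr \<longleftrightarrow>
     sorted (map fst arr) \<and> (\<forall>t\<in>set (map fst arr). 0 \<le> t) \<and>
     (\<forall>i. count_list (map snd arr) i = K * r i)"

fun update :: "'n state \<Rightarrow> 'n event \<Rightarrow> 'n state \<Rightarrow> 'n state" where
  "update r (Arrival i) x = x(i := x i + 1)"
| "update r Match x = (\<lambda>i. x i - r i)"

definition state :: "'n state \<Rightarrow> 'n history \<Rightarrow> 'n state" where
  "state r h = fold (update r) (map snd h) (\<lambda>_. 0)"

definition state_at :: "'n state \<Rightarrow> 'n history \<Rightarrow> real \<Rightarrow> 'n state" where
  "state_at r h t = state r (filter (\<lambda>e. fst e \<le> t) h)"

definition wait_rate :: "('n::finite \<Rightarrow> real) \<Rightarrow> 'n state \<Rightarrow> real" where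
  "wait_rate c x = (\<Sum>i\<in>UNIV. c i * real (x i))"

definition match_times :: "'n history \<Rightarrow> real list" where
  "match_times h = map fst (filter (\<lambda>e. snd e = Match) h)"

definition last_match_time :: "'n history \<Rightarrow> real" where
  "last_match_time h = last (0 # match_times h)"

definition now :: "'n history \<Rightarrow> real" where
  "now h = last (0 # map fst h)"

definition arrivals_of :: "'n history \<Rightarrow> 'n arrivals" where
  "arrivals_of h = [(t, i). (t, Arrival i) \<leftarrow> h]"

definition total_cost ::
    "('n::finite \<Rightarrow> real) \<Rightarrow> 'n state \<Rightarrow> ('n state \<Rightarrow> real) \<Rightarrow> nat \<Rightarrow> 'n history \<Rightarrow> ereal" where
  "total_cost c r f K h =
     (if length (match_times h) = K
      then ereal (integral {0..last_match_time h} (\<lambda>t. wait_rate c (state_at r h t))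
             + (\<Sum>j | j < length h \<and> snd (h ! j) = Match. f (state r (take j h))))
      else \<infinity>)"

text \<open>
  An offline policy sees the whole arrival sequence, so on a given instance it amounts to a choice
  of one of the following histories. The infimum in \<open>opt_cost\<close> is a minimum: moving a match back
  in time to the preceding arrival does not increase the cost, which leaves finitely many
  candidates.
\<close>

definition feasible_history :: "'n state \<Rightarrow> 'n arrivals \<Rightarrow> 'n history \<Rightarrow> bool" where
  "feasible_history r arr h \<longleftrightarrow>
     sorted (map fst h) \<and> (\<forall>t\<in>set (map fst h). 0 \<le> t) \<and>
     arrivals_of h = arr \<and>
     (\<forall>j<length h. snd (h ! j) = Match \<longrightarrow> state r (take j h) \<in> feasible_states r)"

definition opt_cost ::
    "('n::finite \<Rightarrow> real) \<Rightarrow> 'n state \<Rightarrow> ('n state \<Rightarrow> real) \<Rightarrow> nat \<Rightarrow> 'n arrivals \<Rightarrow> ereal" where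
  "opt_cost c r f K arr = (INF h\<in>{h. feasible_history r arr h}. total_cost c r f K h)"

text \<open>
  A deterministic online policy is re-evaluated after every event (and once at time 0). From the
  time-stamped events so far it determines when, measured from the last event, it will execute
  its next match provided no further arrival intervenes; every dependence of its
  decisions on elapsed time is contained in this delay. \<open>Wait\<close> means that no match is executed
  before the next arrival. In \<open>Timer y d\<close> the flag \<open>y\<close> tells whether an arrival at exactly the
  expiry time is processed first (the timer is then discarded and the policy re-evaluated) or the
  match is.
\<close>

datatype decision = Wait | Timer bool real

type_synonym 'n policy = "'n history \<Rightarrow> decision"

definition online_policy :: "'n state \<Rightarrow> 'n policy \<Rightarrow> bool" where
  "online_policy r \<pi> \<longleftrightarrow>
     (\<forall>h y d. \<pi> h = Timer y d \<longrightarrow> 0 \<le> d \<and> state r h \<in> feasible_states r)"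

fun process_arrival :: "'n history \<times> 'n arrivals \<Rightarrow> 'n history \<times> 'n arrivals" where
  "process_arrival (h, []) = (h, [])"
| "process_arrival (h, (s, i) # rest) = (h @ [(s, Arrival i)], rest)"

definition step :: "'n policy \<Rightarrow> 'n history \<times> 'n arrivals \<Rightarrow> 'n history \<times> 'n arrivals" where
  "step \<pi> = (\<lambda>(h, rest). case \<pi> h of
       Wait \<Rightarrow> process_arrival (h, rest)
     | Timer y d \<Rightarrow>
         (let t = now h + d in
          if rest = [] \<or> t < fst (hd rest) \<or> (t = fst (hd rest) \<and> \<not> y)
          then (h @ [(t, Match)], rest)
          else process_arrival (h, rest)))"

text \<open>
  If every \<open>r i\<close> is positive, a policy executes at most as many matches as there are arrivals, so
  after twice as many steps as there are arrivals no further event occurs.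
\<close>

definition run :: "'n policy \<Rightarrow> 'n arrivals \<Rightarrow> 'n history" where
  "run \<pi> arr = fst ((step \<pi> ^^ (2 * length arr)) ([], arr))"

definition policy_cost ::
    "('n::finite \<Rightarrow> real) \<Rightarrow> 'n state \<Rightarrow> ('n state \<Rightarrow> real) \<Rightarrow> nat \<Rightarrow> 'n arrivals \<Rightarrow> 'n policy \<Rightarrow> ereal"
  where
  "policy_cost c r f K arr \<pi> = total_cost c r f K (run \<pi> arr)"

definition wait_since_match :: "('n::finite \<Rightarrow> real) \<Rightarrow> 'n state \<Rightarrow> 'n history \<Rightarrow> real" where
  "wait_since_match c r h =
     integral {last_match_time h..now h} (\<lambda>t. wait_rate c (state_at r h t))"

definition CB :: "real \<Rightarrow> ('n::finite \<Rightarrow> real) \<Rightarrow> 'n state \<Rightarrow> ('n state \<Rightarrow> real) \<Rightarrow> 'n policy" where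
  "CB \<alpha> c r f h =
     (let x = state r h; W = wait_since_match c r h in
      if x \<notin> feasible_states r then Wait
      else if f x \<le> \<alpha> * W then Timer False 0
      else Timer False ((f x / \<alpha> - W) / wait_rate c x))"

lemma online_policy_CB:
  fixes c :: "'n::finite \<Rightarrow> real"
  assumes "\<alpha> > 0" "\<And>i. 0 < c i"
  shows "online_policy r (CB \<alpha> c r f)"
proof -
  have "0 \<le> wait_rate c x" for x
    unfolding wait_rate_def using assms(2) by (auto intro!: sum_nonneg simp: less_imp_le)
  moreover have "0 \<le> y / \<alpha> - W" if "\<not> y \<le> \<alpha> * W" for y W
    using that assms(1) by (simp add: field_simps)
  ultimately show ?thesis
    by (auto simp: online_policy_def CB_def Let_def split: if_splits)
qed

end

theory Submission
  imports Defs
begin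

text \<open>
  Upper bound: let \<open>W\<^sub>k\<close> be the waiting cost of \<open>CB\<close> between its matches \<open>k - 1\<close> and \<open>k\<close>. \<open>CB\<close> pays at most
  \<open>\<alpha> W\<^sub>k\<close> for match \<open>k\<close>. If the offline policy executes its \<open>k\<close>-th match no earlier than \<open>CB\<close>, then
  throughout this period its state dominates that of \<open>CB\<close>, so it waits at cost at least \<open>W\<^sub>k\<close> in the same
  period. Otherwise \<open>CB\<close> refrained from matching although its state already dominated the pre-match
  state of the offline policy, so \<open>\<alpha> W\<^sub>k\<close> is at most the offline cost of match \<open>k\<close>. Hence \<open>CB\<close> pays
  at most \<open>1 + \<alpha>\<close> or \<open>1 + 1 / \<alpha>\<close> times what the offline policy pays for \<open>k\<close>, and different \<open>k\<close> are charged
  to disjoint parts of the offline cost.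

  Lower bound: repeated ski rental. A match costs \<open>1\<close> in state \<open>r\<close> and almost nothing in any larger
  state. Just after the policy has waited at cost \<open>x\<close> and matched, the next \<open>r\<close> agents arrive; the policy
  paid \<open>x + 1\<close>, whereas about \<open>min 1 x\<close> would have sufficed. The last match is expensive for every policy,
  but its share vanishes as the number of rounds grows. If the policy ever waits indefinitely, the
  arrivals stop and its cost is infinite.
\<close>

section \<open>Histories\<close>

text \<open>The leading \<open>0\<close> makes sortedness also forbid events before time 0.\<close>

definition chronological :: "'n history \<Rightarrow> bool" where
  "chronological h \<longleftrightarrow> sorted (0 # map fst h)"

definition matches_feasible :: "'n state \<Rightarrow> 'n history \<Rightarrow> bool" where
  "matches_feasible r h \<longleftrightarrow>
     (\<forall>j<length h. snd (h ! j) = Match \<longrightarrow> state r (take j h) \<in> feasible_states r)"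

text \<open>A list in order of execution, rather than a sum over positions, so that the k-th matches
  of two histories can be compared.\<close>

definition match_costs :: "'n state \<Rightarrow> ('n state \<Rightarrow> real) \<Rightarrow> 'n history \<Rightarrow> real list" where
  "match_costs r f h =
     map (\<lambda>j. f (state r (take j h))) (filter (\<lambda>j. snd (h ! j) = Match) [0..<length h])"

abbreviation num_matches :: "'n history \<Rightarrow> nat" where
  "num_matches h \<equiv> length (match_times h)"

abbreviation arrived :: "'n history \<Rightarrow> 'n \<Rightarrow> nat" where
  "arrived h \<equiv> count_list (map snd (arrivals_of h))"

abbreviation rate_at :: "('n::finite \<Rightarrow> real) \<Rightarrow> 'n state \<Rightarrow> 'n history \<Rightarrow> real \<Rightarrow> real" where
  "rate_at c r h t \<equiv> wait_rate c (state_at r h t)"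

lemma feasible_history_iff:
  "feasible_history r arr h \<longleftrightarrow> chronological h \<and> arrivals_of h = arr \<and> matches_feasible r h"
  by (auto simp: feasible_history_def chronological_def matches_feasible_def)

lemma state_Nil [simp]: "state r [] = (\<lambda>_. 0)"
  by (simp add: state_def)

lemma state_snoc [simp]: "state r (h @ [(t, e)]) = update r e (state r h)"
  by (simp add: state_def)

lemma now_simps [simp]: "now [] = 0" "now (h @ [(t, e)]) = t"
  by (simp_all add: now_def)

lemma arrivals_of_simps [simp]:
  "arrivals_of [] = []"
  "arrivals_of (h @ h') = arrivals_of h @ arrivals_of h'"
  "arrivals_of ((t, Arrival i) # h) = (t, i) # arrivals_of h"
  "arrivals_of ((t, Match) # h) = arrivals_of h"
  by (simp_all add: arrivals_of_def)

lemma match_times_simps [simp]: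
  "match_times [] = []"
  "match_times (h @ h') = match_times h @ match_times h'"
  "match_times ((t, Arrival i) # h) = match_times h"
  "match_times ((t, Match) # h) = t # match_times h"
  by (simp_all add: match_times_def)

lemma last_match_time_snoc [simp]:
  "last_match_time [] = 0"
  "last_match_time (h @ [(t, Arrival i)]) = last_match_time h"
  "last_match_time (h @ [(t, Match)]) = t"
  by (simp_all add: last_match_time_def)

lemma map_fst_arrivals_of: "map fst (arrivals_of h) = map fst (filter (\<lambda>e. snd e \<noteq> Match) h)"
proof (induction h)
  case (Cons x h)
  then show ?case
    by (cases x; cases "snd x") auto
qed simp

lemma chronological_Nil [simp]: "chronological []"
  by (simp add: chronological_def)

lemma chronological_append:
  "chronological (h @ h') \<longleftrightarrow> chronological h \<and> sorted (now h # map fst h')"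
proof (cases h rule: rev_cases)
  case (snoc g x)
  then show ?thesis
    by (cases x) (fastforce simp: chronological_def sorted_append intro: order_trans)
qed (simp add: chronological_def)

lemma chronological_snoc [simp]:
  "chronological (h @ [(t, e)]) \<longleftrightarrow> chronological h \<and> now h \<le> t"
  by (simp add: chronological_append)

lemma chronological_take: "chronological h \<Longrightarrow> chronological (take j h)"
  by (metis append_take_drop_id chronological_append)

lemma now_nonneg: "chronological h \<Longrightarrow> 0 \<le> now h"
  by (induction h rule: rev_induct) auto

lemma le_now: "chronological h \<Longrightarrow> e \<in> set h \<Longrightarrow> fst e \<le> now h"
  by (induction h rule: rev_induct) auto

lemma last_match_time_bounds:
  "chronological h \<Longrightarrow> 0 \<le> last_match_time h \<and> last_match_time h \<le> now h"
proof (induction h rule: rev_induct)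
  case (snoc x h)
  then show ?case
    by (cases x; cases "snd x") (auto dest: now_nonneg)
qed simp

lemma sorted_match_times: "chronological h \<Longrightarrow> sorted (0 # match_times h)"
  unfolding chronological_def match_times_def by (auto intro: sorted_filter)

lemma matches_feasible_Nil [simp]: "matches_feasible r []"
  by (simp add: matches_feasible_def)

lemma matches_feasible_snoc [simp]:
  "matches_feasible r (h @ [e]) \<longleftrightarrow>
     matches_feasible r h \<and> (snd e = Match \<longrightarrow> state r h \<in> feasible_states r)"
  by (auto simp: matches_feasible_def nth_append less_Suc_eq)

lemma matches_feasible_take: "matches_feasible r h \<Longrightarrow> matches_feasible r (take j h)"
  by (auto simp: matches_feasible_def min_def)

lemma match_costs_Nil [simp]: "match_costs r f [] = []"
  by (simp add: match_costs_def)

lemma match_costs_snoc [simp]: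
  "match_costs r f (h @ [(t, e)]) =
     match_costs r f h @ (if e = Match then [f (state r h)] else [])"
proof -
  have "filter (\<lambda>j. snd ((h @ [(t, e)]) ! j) = Match) [0..<length h] =
        filter (\<lambda>j. snd (h ! j) = Match) [0..<length h]"
    by (rule filter_cong) (auto simp: nth_append)
  then show ?thesis
    by (auto simp: match_costs_def)
qed

lemma length_match_costs [simp]: "length (match_costs r f h) = num_matches h"
proof (induction h rule: rev_induct)
  case (snoc x h)
  then show ?case
    by (cases x; cases "snd x") auto
qed simp

lemma length_history: "length h = length (arrivals_of h) + num_matches h"
proof (induction h rule: rev_induct)
  case (snoc x h)
  then show ?case
    by (cases x; cases "snd x") auto
qed simp

lemma total_cost_eq:
  "total_cost c r f K h =
     (if num_matches h = K
      then ereal (integral {0..last_match_time h} (rate_at c r h) + sum_list (match_costs r f h))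
      else \<infinity>)"
proof -
  have "(\<Sum>j | j < length h \<and> snd (h ! j) = Match. f (state r (take j h))) =
        (\<Sum>j\<in>set (filter (\<lambda>j. snd (h ! j) = Match) [0..<length h]). f (state r (take j h)))"
    by (rule sum.cong) auto
  also have "\<dots> = sum_list (match_costs r f h)"
    unfolding match_costs_def by (simp add: sum_list_distinct_conv_sum_set)
  finally show ?thesis
    by (simp add: total_cost_def)
qed

text \<open>Costs are charged by the number of the match, whereas states are read off prefixes of
  the history; this translates between the two.\<close>

lemma nth_match:
  assumes "k < num_matches h"
  obtains j where "j < length h" "h ! j = (match_times h ! k, Match)"
    "num_matches (take j h) = k" "match_costs r f h ! k = f (state r (take j h))"
proof -
  have "\<exists>j<length h. h ! j = (match_times h ! k, Match) \<and> num_matches (take j h) = k \<and>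
          match_costs r f h ! k = f (state r (take j h))"
    using assms
  proof (induction h rule: rev_induct)
    case (snoc x h)
    obtain t e where x: "x = (t, e)"
      by (cases x)
    show ?case
    proof (cases "k < num_matches h")
      case True
      then obtain j where "j < length h" "h ! j = (match_times h ! k, Match)"
          "num_matches (take j h) = k" "match_costs r f h ! k = f (state r (take j h))"
        using snoc.IH by blast
      then show ?thesis
        using True x by (intro exI[of _ j]) (auto simp: nth_append)
    next
      case False
      then have "e = Match" "k = num_matches h"
        using snoc.prems x by (cases e; auto)+
      then show ?thesis
        using x by (intro exI[of _ "length h"]) (auto simp: nth_append)
    qed
  qed simp
  then show ?thesis
    using that by blast
qed

lemma match_times_take: "match_times (take j h) = take (num_matches (take j h)) (match_times h)"
  by (metis append_eq_conv_conj append_take_drop_id match_times_simps(2))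

text \<open>Conservation of agents: feasibility ensures that the truncated subtraction in
  \<open>update\<close> really removes \<open>r i\<close> agents.\<close>

lemma state_balance:
  "matches_feasible r h \<Longrightarrow> state r h i + num_matches h * r i = arrived h i"
proof (induction h rule: rev_induct)
  case (snoc x h)
  then show ?case
    by (cases x; cases "snd x") (auto simp: feasible_states_def)
qed simp

section \<open>States at a given time\<close>

lemma filter_le_chronological:
  assumes "chronological h" "now h \<le> t"
  shows "filter (\<lambda>e. fst e \<le> t) h = h"
  using assms le_now by (fastforce simp: filter_id_conv)

lemma state_at_now: "chronological h \<Longrightarrow> now h \<le> t \<Longrightarrow> state_at r h t = state r h"
  by (simp add: state_at_def filter_le_chronological)

lemma state_at_append:
  assumes "chronological (h @ h')" "h' = [] \<or> t < fst (hd h')"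
  shows "state_at r (h @ h') t = state_at r h t"
proof -
  have "filter (\<lambda>e. fst e \<le> t) h' = []"
    using assms by (cases h') (auto simp: chronological_append filter_empty_conv)
  then show ?thesis
    by (simp add: state_at_def)
qed

lemma matches_feasible_filter:
  assumes "chronological h" "matches_feasible r h"
  shows "matches_feasible r (filter (\<lambda>e. fst e \<le> t) h)"
  using assms
proof (induction h rule: rev_induct)
  case (snoc x h)
  then show ?case
    by (cases x) (auto simp: filter_le_chronological)
qed simp

lemma match_times_filter:
  "match_times (filter (\<lambda>e. fst e \<le> t) h) = filter (\<lambda>s. s \<le> t) (match_times h)"
proof (induction h rule: rev_induct)
  case (snoc x h)
  then show ?case
    by (cases x; cases "snd x") auto
qed simp

lemma arrivals_of_filter:
  "arrivals_of (filter (\<lambda>e. fst e \<le> t) h) = filter (\<lambda>a. fst a \<le> t) (arrivals_of h)"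
proof (induction h rule: rev_induct)
  case (snoc x h)
  then show ?case
    by (cases x; cases "snd x") auto
qed simp

text \<open>For fixed arrivals, the state at time \<open>t\<close> is thus governed by the number of
  matches so far alone; two histories are compared through this number.\<close>

lemma state_at_balance:
  assumes "chronological h" "matches_feasible r h"
  shows "state_at r h t i + length (filter (\<lambda>s. s \<le> t) (match_times h)) * r i =
         count_list (map snd (filter (\<lambda>a. fst a \<le> t) (arrivals_of h))) i"
  using state_balance[OF matches_feasible_filter[OF assms]]
  unfolding state_at_def match_times_filter arrivals_of_filter by blast

section \<open>Waiting costs\<close>

text \<open>The rate is a step function: appending an event at \<open>s\<close> leaves it unchanged
  before \<open>s\<close> and makes it constant from \<open>s\<close> on.\<close>

lemma rate_at_integrable:
  "chronological h \<Longrightarrow> rate_at c r h integrable_on {a..b}"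
proof (induction h arbitrary: a b rule: rev_induct)
  case Nil
  then show ?case
    by (simp add: state_at_def integrable_const_ivl)
next
  case (snoc x h)
  obtain s e where x: "x = (s, e)"
    by (cases x)
  let ?h = "h @ [(s, e)]"
  have h: "chronological h" "now h \<le> s" "chronological ?h"
    using snoc.prems x by auto
  \<comment> \<open>At \<open>s\<close> itself the new event already counts, so the two rates may
    differ at this one point.\<close>
  have left: "rate_at c r ?h integrable_on {a..b}" if "b \<le> s" for a b
    using snoc.IH[OF h(1), of a b]
    by (rule integrable_spike_finite[of "{s}", rotated -1])
       (use that state_at_append[OF h(3)] in auto)
  have right: "rate_at c r ?h integrable_on {a..b}" if "s \<le> a" for a b
  proof -
    have "(\<lambda>_. wait_rate c (state r ?h)) integrable_on {a..b}"
      by (rule integrable_const_ivl)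
    then show ?thesis
      by (rule integrable_eq) (use that state_at_now[OF h(3)] in auto)
  qed
  show ?case
  proof (cases "a \<le> s \<and> s \<le> b")
    case True
    then show ?thesis
      unfolding x by (intro Henstock_Kurzweil_Integration.integrable_combine[of a s b] left right) auto
  next
    case False
    then show ?thesis
      unfolding x using left[of b a] right[of a b] by linarith
  qed
qed

lemma integral_rate_at_split:
  assumes "chronological h" "a \<le> b" "b \<le> d"
  shows "integral {a..d} (rate_at c r h) =
         integral {a..b} (rate_at c r h) + integral {b..d} (rate_at c r h)"
  using Henstock_Kurzweil_Integration.integral_combine[OF assms(2,3) rate_at_integrable[OF assms(1)]]
  by simp

text \<open>The first dropped event may occur exactly at \<open>b\<close>: one endpoint does not
  affect the integral, hence the passage to the open interval.\<close>

lemma integral_rate_at_append: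
  assumes "chronological (h @ h')" "h' = [] \<or> b \<le> fst (hd h')"
  shows "integral {a..b} (rate_at c r (h @ h')) = integral {a..b} (rate_at c r h)"
  unfolding integral_open_interval_real
  by (rule Henstock_Kurzweil_Integration.integral_cong)
     (use assms state_at_append[OF assms(1)] in \<open>auto simp: chronological_append\<close>)

lemma integral_rate_at_now:
  assumes "chronological h" "now h \<le> b"
  shows "integral {now h..b} (rate_at c r h) = (b - now h) * wait_rate c (state r h)"
proof -
  have "integral {now h..b} (rate_at c r h) = integral {now h..b} (\<lambda>_. wait_rate c (state r h))"
    by (rule Henstock_Kurzweil_Integration.integral_cong) (use assms in \<open>auto simp: state_at_now\<close>)
  then show ?thesis
    using assms by simp
qed

lemma wait_rate_nonneg: "(\<And>i. 0 < c i) \<Longrightarrow> 0 \<le> wait_rate c x"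
  unfolding wait_rate_def by (auto intro!: sum_nonneg simp: less_imp_le)

lemma wait_rate_mono: "(\<And>i. 0 < c i) \<Longrightarrow> x \<le> y \<Longrightarrow> wait_rate c x \<le> wait_rate c y"
  unfolding wait_rate_def
  by (auto intro!: sum_mono mult_left_mono simp: less_imp_le le_fun_def)

lemma wait_rate_pos:
  assumes "\<And>i. 0 < c i" "\<And>i. 1 \<le> x i"
  shows "0 < wait_rate c x"
  unfolding wait_rate_def
  by (rule sum_pos) (use assms less_le_trans[OF zero_less_one] in \<open>auto simp: Suc_le_eq\<close>)

lemma integral_rate_at_nonneg:
  "(\<And>i. 0 < c i) \<Longrightarrow> chronological h \<Longrightarrow> 0 \<le> integral {a..b} (rate_at c r h)"
  by (rule Henstock_Kurzweil_Integration.integral_nonneg) (auto intro: rate_at_integrable wait_rate_nonneg)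

section \<open>Executions of online policies\<close>

lemma step_cases [consumes 1, case_names stop arrive match]:
  assumes "step \<pi> (h, rest) = (h', rest')"
  obtains "\<pi> h = Wait" "rest = []" "h' = h" "rest' = []"
  | s i where "rest = (s, i) # rest'" "h' = h @ [(s, Arrival i)]"
      "\<And>y d. \<pi> h = Timer y d \<Longrightarrow> s \<le> now h + d \<and> (y \<or> s < now h + d)"
  | y d where "\<pi> h = Timer y d" "h' = h @ [(now h + d, Match)]" "rest' = rest"
      "rest = [] \<or> now h + d \<le> fst (hd rest)"
  using assms
  by (cases rest)
     (force simp: step_def Let_def split: decision.splits if_splits)+

text \<open>
  Besides the validity of the history produced so far, the invariant records that every event in it
  is the outcome of the step that the policy takes from the preceding prefix.
\<close>

definition execution :: "'n state \<Rightarrow> 'n policy \<Rightarrow> 'n arrivals \<Rightarrow> 'n history \<Rightarrow> 'n arrivals \<Rightarrow> bool" where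
  "execution r \<pi> arr h rest \<longleftrightarrow>
     chronological h \<and> matches_feasible r h \<and> sorted (now h # map fst rest) \<and>
     arrivals_of h @ rest = arr \<and>
     (\<forall>j<length h. \<exists>rest'. arrivals_of (take j h) @ rest' = arr \<and>
        fst (step \<pi> (take j h, rest')) = take (Suc j) h)"

lemma execution_step:
  assumes "online_policy r \<pi>" "execution r \<pi> arr h rest" "step \<pi> (h, rest) = (h', rest')"
  shows "execution r \<pi> arr h' rest'"
proof -
  have prefixes: "\<forall>j<length h'. \<exists>rest''. arrivals_of (take j h') @ rest'' = arr \<and>
        fst (step \<pi> (take j h', rest'')) = take (Suc j) h'"
    if "h' = h @ [e]" for e
    using that assms(2,3)
    by (auto simp: execution_def less_Suc_eq all_conj_distrib)
  from assms(3) show ?thesis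
  proof (cases rule: step_cases)
    case stop
    then show ?thesis
      using assms(2) by simp
  next
    case (arrive s i)
    then show ?thesis
      using assms(2) prefixes[OF arrive(2)] by (auto simp: execution_def)
  next
    case (match y d)
    then have "0 \<le> d" "state r h \<in> feasible_states r"
      using assms(1) by (auto simp: online_policy_def)
    then show ?thesis
      using match assms(2) prefixes[OF match(2)]
      by (cases rest) (auto simp: execution_def)
  qed
qed

text \<open>A step adds exactly one event unless the run is finished, and a finished run is a fixed
  point of \<open>step\<close>.\<close>

lemma execution_funpow:
  assumes "online_policy r \<pi>" "sorted (0 # map fst arr)"
  shows "(step \<pi> ^^ n) ([], arr) = (h, rest) \<Longrightarrow>
    execution r \<pi> arr h rest \<and> (length h = n \<or> (rest = [] \<and> \<pi> h = Wait))"
proof (induction n arbitrary: h rest)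
  case 0
  then show ?case
    using assms(2) by (auto simp: execution_def)
next
  case (Suc n)
  obtain g rest0 where g: "(step \<pi> ^^ n) ([], arr) = (g, rest0)"
    by (cases "(step \<pi> ^^ n) ([], arr)")
  then have step: "step \<pi> (g, rest0) = (h, rest)"
    using Suc.prems by simp
  show ?case
    using Suc.IH[OF g] execution_step[OF assms(1) _ step] step
    by (cases rule: step_cases[OF step]) (auto simp: step_def)
qed

section \<open>Completeness of runs\<close>

lemma count_list_le_length: "count_list xs x \<le> length xs"
  by (induction xs) auto

lemma balanced_sorted: "balanced r K arr \<Longrightarrow> sorted (0 # map fst arr)"
  by (simp add: balanced_def)

lemma num_matches_le:
  assumes "balanced r K arr" "\<And>i. 1 \<le> r i" "matches_feasible r h" "arrivals_of h @ rest = arr"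
  shows "num_matches h \<le> K"
proof -
  fix i :: 'a
  have "num_matches h * r i \<le> arrived h i"
    using state_balance[OF assms(3), of i] by linarith
  also have "\<dots> \<le> K * r i"
    using assms(1) unfolding balanced_def assms(4)[symmetric]
    by (metis count_list_append le_add1 map_append)
  finally show ?thesis
    using assms(2)[of i] by simp
qed

lemma balanced_K_le_length:
  assumes "balanced r K arr" "\<And>i. 1 \<le> r i"
  shows "K \<le> length arr"
proof -
  fix i :: 'a
  have "K \<le> K * r i"
    using assms(2)[of i] by simp
  also have "\<dots> = count_list (map snd arr) i"
    using assms(1) by (simp add: balanced_def)
  also have "\<dots> \<le> length arr"
    using count_list_le_length[of "map snd arr" i] by simp
  finally show ?thesis .
qed

lemma run_complete:
  assumes "online_policy r \<pi>" "balanced r K arr" "\<And>i. 1 \<le> r i"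
    and patient: "\<And>h. \<pi> h = Wait \<Longrightarrow> state r h \<notin> feasible_states r"
  shows "execution r \<pi> arr (run \<pi> arr) [] \<and> num_matches (run \<pi> arr) = K"
proof -
  obtain h rest where steps: "(step \<pi> ^^ (2 * length arr)) ([], arr) = (h, rest)"
    by (cases "(step \<pi> ^^ (2 * length arr)) ([], arr)")
  then have run: "run \<pi> arr = h"
    by (simp add: run_def)
  have exec: "execution r \<pi> arr h rest"
    and final: "length h = 2 * length arr \<or> (rest = [] \<and> \<pi> h = Wait)"
    using execution_funpow[OF assms(1) balanced_sorted[OF assms(2)] steps] by auto
  have arr: "arrivals_of h @ rest = arr" and feas: "matches_feasible r h"
    using exec by (auto simp: execution_def)
  have le: "num_matches h \<le> K"
    by (rule num_matches_le[OF assms(2,3) feas arr])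
  have "rest = [] \<and> num_matches h = K"
    using final
  proof
    \<comment> \<open>The history consists of at most \<open>length arr\<close> arrivals and at most
      \<open>K \<le> length arr\<close> matches; exhausting the step budget forces both numbers to
      be maximal.\<close>
    assume "length h = 2 * length arr"
    moreover have "length arr = length (arrivals_of h) + length rest"
      using arr by auto
    ultimately have "length rest = 0 \<and> num_matches h = K"
      using le balanced_K_le_length[OF assms(2,3)] length_history[of h] by linarith
    then show ?thesis
      by simp
  next
    assume stopped: "rest = [] \<and> \<pi> h = Wait"
    then have "state r h \<notin> feasible_states r"
      using patient by blast
    \<comment> \<open>All \<open>K * r i\<close> agents of type \<open>i\<close> have arrived and
      fewer than \<open>r i\<close> are left, so no match can be missing.\<close>
    then obtain i where i: "state r h i < r i"
      by (auto simp: feasible_states_def not_le)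
    have "state r h i + num_matches h * r i = K * r i"
      using state_balance[OF feas, of i] arr stopped assms(2) by (auto simp: balanced_def)
    then have "K * r i < (num_matches h + 1) * r i"
      using i by simp
    then have "K < num_matches h + 1"
      by (metis mult_less_cancel2)
    then show ?thesis
      using stopped le by simp
  qed
  then show ?thesis
    using run exec by simp
qed

section \<open>The policy CB\<close>

lemma CB_Wait_iff: "CB \<alpha> c r f h = Wait \<longleftrightarrow> state r h \<notin> feasible_states r"
  by (simp add: CB_def Let_def)

lemma feasible_wait_rate_pos:
  assumes "\<And>i. 0 < c i" "\<And>i. 1 \<le> r i" "x \<in> feasible_states r"
  shows "0 < wait_rate c x"
  using assms(2,3) by (intro wait_rate_pos assms(1)) (auto simp: feasible_states_def intro: order_trans)

lemma wait_until:
  assumes "chronological h" "now h \<le> t"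
  shows "integral {last_match_time h..t} (rate_at c r h) =
         wait_since_match c r h + (t - now h) * wait_rate c (state r h)"
  using integral_rate_at_split[OF assms(1), of "last_match_time h" "now h" t] assms
    last_match_time_bounds[OF assms(1)] integral_rate_at_now[OF assms]
  by (simp add: wait_since_match_def)

text \<open>The timer length is multiplied out, the waiting rate being positive in feasible states:
  unless the match is due at once, the timer expires exactly when \<alpha> times the wait reaches
  the matching cost.\<close>

lemma CB_timer:
  assumes "0 < \<alpha>" "\<And>i. 0 < c i" "\<And>i. 1 \<le> r i" "chronological h" "CB \<alpha> c r f h = Timer y d"
  defines "W \<equiv> wait_since_match c r h"
  shows "\<not> y" "state r h \<in> feasible_states r"
    "d = 0 \<and> f (state r h) \<le> \<alpha> * W \<or>
     \<alpha> * (W + d * wait_rate c (state r h)) = f (state r h)"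
proof -
  show feas: "state r h \<in> feasible_states r" and "\<not> y"
    using assms(5) by (auto simp: CB_def Let_def split: if_splits)
  have "0 < wait_rate c (state r h)"
    using feasible_wait_rate_pos[OF assms(2,3) feas] .
  then show "d = 0 \<and> f (state r h) \<le> \<alpha> * W \<or>
     \<alpha> * (W + d * wait_rate c (state r h)) = f (state r h)"
    using assms(1,5) by (auto simp: CB_def Let_def W_def field_simps split: if_splits)
qed

text \<open>Prefixes of one list are comparable, and \<open>P\<close> cannot extend beyond
  \<open>P'\<close>, since the next entry comes after \<sigma>.\<close>

lemma prefix_counts_le:
  fixes P :: "(real \<times> 'n) list"
  assumes "P @ Q = P' @ Q'" "\<And>p. p \<in> set P \<Longrightarrow> fst p \<le> \<sigma>" "Q' = [] \<or> \<sigma> < fst (hd Q')"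
  shows "count_list (map snd P) i \<le> count_list (map snd P') i"
proof -
  from assms(1) consider us where "P' = P @ us" | us where "P = P' @ us" "Q' = us @ Q"
    by (auto simp: append_eq_append_conv2)
  then show ?thesis
  proof cases
    case (2 us)
    have "us = []"
    proof (rule ccontr)
      assume "us \<noteq> []"
      then show False
        using 2 assms(2)[of "hd us"] assms(3) by (cases us) auto
    qed
    then show ?thesis
      using 2 by simp
  qed simp
qed

text \<open>
  If a match is feasible after \<open>k\<close> matches for some arrivals strictly before the \<open>k + 1\<close>-st match of
  \<open>CB\<close>, then \<open>CB\<close> was already running its timer, which did not expire earlier. As further arrivals only
  lower \<open>f\<close>, the wait is bounded by the matching cost at the earlier state.
\<close>

lemma CB_match:
  assumes "0 < \<alpha>" "\<And>i. 0 < c i" "\<And>i. 1 \<le> r i" "matching_cost r f"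
    and exec: "execution r (CB \<alpha> c r f) arr H []" and j: "j < length H" "H ! j = (\<tau>, Match)"
  defines "h \<equiv> take j H"
  shows "f (state r h) \<le> \<alpha> * integral {last_match_time h..\<tau>} (rate_at c r h)"
    and "\<lbrakk>y \<in> feasible_states r; \<sigma> < \<tau>; P @ Q = arr; \<And>p. p \<in> set P \<Longrightarrow> fst p \<le> \<sigma>;
       \<And>i. y i + num_matches h * r i = count_list (map snd P) i\<rbrakk>
      \<Longrightarrow> \<alpha> * integral {last_match_time h..\<tau>} (rate_at c r h) \<le> f y"
proof -
  let ?W = "\<lambda>h t. integral {last_match_time h..t} (rate_at c r h)"
  note timer = CB_timer[OF assms(1-3)]
  have chron: "chronological H" and feas: "matches_feasible r H"
    and steps: "\<And>j. j < length H \<Longrightarrow> \<exists>rest'. arrivals_of (take j H) @ rest' = arr \<and>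
        fst (step (CB \<alpha> c r f) (take j H, rest')) = take (Suc j) H"
    using exec by (auto simp: execution_def)
  have antimono: "f x' \<le> f x" if "x \<in> feasible_states r" "x' \<in> feasible_states r" "x \<le> x'" for x x'
    using assms(4) that by (auto simp: matching_cost_def monotone_on_def)
  have f_pos: "0 < f x" if "x \<in> feasible_states r" for x
    using assms(4) that by (auto simp: matching_cost_def)
  obtain rest where arr: "arrivals_of h @ rest = arr"
    and "fst (step (CB \<alpha> c r f) (h, rest)) = take (Suc j) H"
    using steps[OF j(1)] h_def by auto
  then obtain rest2 where st: "step (CB \<alpha> c r f) (h, rest) = (h @ [(\<tau>, Match)], rest2)"
    using j by (cases "step (CB \<alpha> c r f) (h, rest)") (auto simp: take_Suc_conv_app_nth h_def)
  obtain d b where d: "CB \<alpha> c r f h = Timer b d" "\<tau> = now h + d" "rest = [] \<or> \<tau> \<le> fst (hd rest)"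
    using st by (cases rule: step_cases) auto
  have h: "chronological h" "matches_feasible r h"
    using chron feas by (auto simp: h_def chronological_take matches_feasible_take)
  have "chronological (h @ [(\<tau>, Match)])"
    using chronological_take[OF chron, of "Suc j"] j by (simp add: take_Suc_conv_app_nth h_def)
  then have now_le: "now h \<le> \<tau>"
    by simp
  have W: "?W h \<tau> = wait_since_match c r h + d * wait_rate c (state r h)"
    using wait_until[OF h(1) now_le, of c r] d(2) by simp
  note tm = timer[OF h(1) d(1)]
  show first: "f (state r h) \<le> \<alpha> * ?W h \<tau>"
    using tm(3) W by auto
  assume y: "y \<in> feasible_states r" "\<sigma> < \<tau>" "P @ Q = arr" "\<And>p. p \<in> set P \<Longrightarrow> fst p \<le> \<sigma>"
    "\<And>i. y i + num_matches h * r i = count_list (map snd P) i"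
  \<comment> \<open>Used for \<open>h\<close> and also for the prefix before its last arrival: both
    contain all arrivals of \<open>P\<close> and equally many matches.\<close>
  have dominates: "y \<le> state r g \<and> state r g \<in> feasible_states r"
    if g: "matches_feasible r g" "num_matches g = num_matches h" "arrivals_of g @ rest' = arr"
      "rest' = [] \<or> \<tau> \<le> fst (hd rest')" for g rest'
  proof -
    have "y i \<le> state r g i" for i
    proof -
      have "count_list (map snd P) i \<le> arrived g i"
        by (rule prefix_counts_le[of P Q _ rest' \<sigma>]) (use y g in auto)
      then show ?thesis
        using y(5)[of i] state_balance[OF g(1), of i] g(2) by simp
    qed
    then show ?thesis
      using y(1) by (auto simp: le_fun_def feasible_states_def intro: order_trans)
  qed
  have y_le: "f (state r h) \<le> f y"
    using dominates[OF h(2) refl arr d(3)] antimono y(1) by blast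
  show "\<alpha> * ?W h \<tau> \<le> f y"
  proof (cases "\<alpha> * (wait_since_match c r h + d * wait_rate c (state r h)) = f (state r h)")
    case True
    then show ?thesis
      using W y_le by simp
  next
    \<comment> \<open>The match is due at once and without equality. Then an arrival at \<tau>
      itself has just lowered the cost, and the bound comes from the timer that was running before
      this arrival.\<close>
    case False
    then have \<tau>: "\<tau> = now h" and le: "f (state r h) \<le> \<alpha> * wait_since_match c r h"
      using tm(3) d(2) by auto
    then have pos: "0 < \<alpha> * wait_since_match c r h"
      using f_pos[OF tm(2)] by linarith
    \<comment> \<open>An empty history, or one that ends with a match, has accumulated no waiting
      cost.\<close>
    have "h \<noteq> []"
      using pos by (auto simp: wait_since_match_def)
    then obtain g x where "h = g @ [x]"
      by (metis rev_exhaust)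
    then obtain s e where hg: "h = g @ [(s, e)]"
      by (metis surj_pair)
    have "e \<noteq> Match"
      using pos hg by (auto simp: wait_since_match_def)
    then obtain i where e: "e = Arrival i"
      by (cases e) auto
    have s: "s = \<tau>"
      using \<tau> hg by simp
    have len: "length g < j" "g = take (length g) H" "take (Suc (length g)) H = h"
    proof -
      have lh: "length h = j"
        using j by (simp add: h_def)
      then show lt: "length g < j"
        using hg by simp
      have "take (length g) h = g"
        using hg by simp
      then show "g = take (length g) H"
        using lt by (simp add: h_def min_def)
      have "Suc (length g) = j"
        using lh hg by simp
      then show "take (Suc (length g)) H = h"
        by (simp add: h_def)
    qed
    obtain rest' where g_arr: "arrivals_of g @ rest' = arr"
      and "fst (step (CB \<alpha> c r f) (g, rest')) = h"
      using steps[of "length g"] len j(1) by auto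
    then obtain rest'' where st': "step (CB \<alpha> c r f) (g, rest') = (g @ [(s, Arrival i)], rest'')"
      using hg e by (cases "step (CB \<alpha> c r f) (g, rest')") auto
    then have r': "rest' = (s, i) # rest''"
      and no_fire: "\<And>y d. CB \<alpha> c r f g = Timer y d \<Longrightarrow> s \<le> now g + d \<and> (y \<or> s < now g + d)"
      by (cases rule: step_cases; auto)+
    have g: "chronological g" "matches_feasible r g" "now g \<le> s"
      using h hg by auto
    have dom: "y \<le> state r g" "state r g \<in> feasible_states r"
      using dominates[OF g(2) _ g_arr] r' s hg e by auto
    obtain b' d' where d': "CB \<alpha> c r f g = Timer b' d'"
      using dom(2) CB_Wait_iff by (metis decision.exhaust)
    note tm' = timer[OF g(1) d']
    have lt: "s < now g + d'"
      using no_fire[OF d'] tm'(1) by auto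
    \<comment> \<open>The arrival preceded the expiry, so \<open>d'\<close> is positive and this
      timer aims at exact balance.\<close>
    have eq: "\<alpha> * (wait_since_match c r g + d' * wait_rate c (state r g)) = f (state r g)"
      using tm'(3) lt g(3) by auto
    have "?W h \<tau> = ?W g s"
      using integral_rate_at_append[of g "[(s, Arrival i)]" s] h(1) hg e s by simp
    also have "\<dots> = wait_since_match c r g + (s - now g) * wait_rate c (state r g)"
      using wait_until[OF g(1,3)] .
    also have "\<dots> \<le> wait_since_match c r g + d' * wait_rate c (state r g)"
      using lt wait_rate_nonneg[of c "state r g"] assms(2) by (intro add_left_mono mult_right_mono) auto
    finally have "\<alpha> * ?W h \<tau> \<le> f (state r g)"
      using assms(1) eq by (metis mult_left_mono less_imp_le)
    also have "\<dots> \<le> f y"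
      using antimono[OF y(1) dom(2) dom(1)] .
    finally show ?thesis .
  qed
qed

section \<open>Charging CB to an offline history\<close>

lemma last_Cons_take: "n \<le> length ys \<Longrightarrow> last (a # take n ys) = (a # ys) ! n"
  by (induction ys arbitrary: n a) (auto simp: take_Cons nth_Cons split: nat.splits)

lemma last_match_time_take:
  "last_match_time (take j h) = (0 # match_times h) ! num_matches (take j h)"
proof -
  have "num_matches (take j h) \<le> num_matches h"
    by (metis append_take_drop_id le_add1 length_append match_times_simps(2))
  then show ?thesis
    unfolding last_match_time_def by (metis match_times_take last_Cons_take)
qed

lemma last_match_time_nth: "last_match_time h = (0 # match_times h) ! num_matches h"
  using last_match_time_take[of "length h" h] by simp

lemma sorted_length_filter_le_ge:
  fixes xs :: "real list"
  assumes "sorted xs" "k < length xs" "xs ! k \<le> t"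
  shows "k < length (filter (\<lambda>s. s \<le> t) xs)"
proof -
  have "xs ! i \<le> t" if "i \<le> k" for i
    using sorted_nth_mono[OF assms(1) that assms(2)] assms(3) by linarith
  then have "filter (\<lambda>s. s \<le> t) (take (Suc k) xs) = take (Suc k) xs"
    by (auto simp: filter_id_conv in_set_conv_nth)
  then have "filter (\<lambda>s. s \<le> t) xs = take (Suc k) xs @ filter (\<lambda>s. s \<le> t) (drop (Suc k) xs)"
    by (metis append_take_drop_id filter_append)
  then show ?thesis
    using assms(2) by simp
qed

lemma sorted_length_filter_le_less:
  fixes xs :: "real list"
  assumes "sorted xs" "k < length xs" "t < xs ! k"
  shows "length (filter (\<lambda>s. s \<le> t) xs) \<le> k"
proof -
  have "t < xs ! i" if "k \<le> i" "i < length xs" for i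
    using sorted_nth_mono[OF assms(1) that] assms(3) by linarith
  then have "filter (\<lambda>s. s \<le> t) (drop k xs) = []"
    by (auto simp: filter_empty_conv in_set_conv_nth not_le)
  then have "filter (\<lambda>s. s \<le> t) xs = filter (\<lambda>s. s \<le> t) (take k xs)"
    by (metis append_take_drop_id filter_append append_Nil2)
  then show ?thesis
    by (metis length_filter_le length_take min.bounded_iff)
qed

text \<open>In the period before its match \<open>k\<close>, counted from 0, \<open>H\<close> has
  executed at least \<open>k\<close> matches and \<open>G\<close> at most \<open>k\<close>, so the
  state of \<open>G\<close> dominates.\<close>

lemma wait_le_later_matches:
  assumes c: "\<And>i. 0 < c i"
    and G: "chronological G" "matches_feasible r G"
    and H: "chronological H" "matches_feasible r H" "arrivals_of H = arrivals_of G"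
    and k: "k < num_matches G" "k < num_matches H"
    and later: "match_times H ! k \<le> match_times G ! k"
  shows "integral {(0 # match_times H) ! k..match_times H ! k} (rate_at c r H) \<le>
         integral {(0 # match_times H) ! k..match_times H ! k} (rate_at c r G)"
  unfolding integral_open_interval_real
proof (rule integral_le)
  fix t assume "t \<in> {(0 # match_times H) ! k<..<match_times H ! k}"
  then have t: "(0 # match_times H) ! k \<le> t" "t < match_times G ! k"
    using later by auto
  let ?n = "\<lambda>h. length (filter (\<lambda>s. s \<le> t) (match_times h))"
  have "k \<le> ?n H"
  proof (cases k)
    case (Suc l)
    then show ?thesis
      using sorted_length_filter_le_ge[of "match_times H" l t] sorted_match_times[OF H(1)] k(2) t(1)
      by simp
  qed simp
  \<comment> \<open>This needs \<open>t\<close> strictly before the match of \<open>G\<close>, hence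
    the passage to the open interval.\<close>
  moreover have "?n G \<le> k"
    using sorted_length_filter_le_less[of "match_times G" k t] sorted_match_times[OF G(1)] k(1) t(2)
    by simp
  ultimately have n: "?n G \<le> ?n H"
    by linarith
  have "state_at r H t i \<le> state_at r G t i" for i
    using state_at_balance[OF H(1,2), of t i] state_at_balance[OF G, of t i] H(3)
      mult_le_mono1[OF n, of "r i"] unfolding H(3) by linarith
  then show "rate_at c r H t \<le> rate_at c r G t"
    by (intro wait_rate_mono c) (simp add: le_fun_def)
qed (auto simp: integrable_on_open_interval_real intro: rate_at_integrable G(1) H(1))

lemma CB_le_offline:
  assumes \<alpha>: "0 < \<alpha>" and c: "\<And>i. 0 < c i" and r: "\<And>i. 1 \<le> r i" and f: "matching_cost r f"
    and bal: "balanced r K arr" and G: "feasible_history r arr G" "num_matches G = K"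
  shows "policy_cost c r f K arr (CB \<alpha> c r f) \<le>
    ereal (1 + max \<alpha> (1 / \<alpha>)) * total_cost c r f K G"
proof -
  let ?C = "1 + max \<alpha> (1 / \<alpha>)"
  define H where "H = run (CB \<alpha> c r f) arr"
  have exec: "execution r (CB \<alpha> c r f) arr H []" and HK: "num_matches H = K"
    using run_complete[OF online_policy_CB bal r] \<alpha> c CB_Wait_iff unfolding H_def by blast+
  have H: "chronological H" "matches_feasible r H" "arrivals_of H = arr"
    using exec by (auto simp: execution_def)
  have G': "chronological G" "matches_feasible r G" "arrivals_of G = arr"
    using G(1) by (auto simp: feasible_history_iff)
  let ?\<tau> = "match_times H" and ?\<sigma> = "match_times G"
  let ?T = "last_match_time G"
  define W where "W k = integral {(0 # ?\<tau>) ! k..?\<tau> ! k} (rate_at c r H)" for k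
  define A where "A t = integral {0..t} (rate_at c r G)" for t
  have A_mono: "A s \<le> A t" if "0 \<le> s" "s \<le> t" for s t
    using integral_rate_at_split[OF G'(1) that, of c r] integral_rate_at_nonneg[OF c G'(1), where a = s and b = t and r = r]
    by (simp add: A_def)
  have \<tau>_nonneg: "0 \<le> (0 # ?\<tau>) ! k" if "k \<le> K" for k
    using sorted_nth_mono[OF sorted_match_times[OF H(1)], of 0 k] that HK by simp
  have \<tau>_mono: "(0 # ?\<tau>) ! k \<le> ?\<tau> ! k" if "k < K" for k
    using sorted_nth_mono[OF sorted_match_times[OF H(1)], of k "Suc k"] that HK by simp
  have T_nonneg: "0 \<le> ?T"
    using last_match_time_bounds[OF G'(1)] by simp
  have \<sigma>_le: "?\<sigma> ! k \<le> ?T" if "k < K" for k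
    using sorted_nth_mono[OF sorted_match_times[OF G'(1)], of "Suc k" K] that G(2)
    by (simp add: last_match_time_nth)
  \<comment> \<open>Times are cut off at \<open>?T\<close> because the offline cost counts no
    waiting after the last offline match.\<close>
  have per_match: "W k + match_costs r f H ! k \<le>
      ?C * (match_costs r f G ! k + (A (min (?\<tau> ! k) ?T) - A (min ((0 # ?\<tau>) ! k) ?T)))"
    if k: "k < K" for k
  proof -
    obtain j where j: "j < length H" "H ! j = (?\<tau> ! k, Match)" "num_matches (take j H) = k"
      "match_costs r f H ! k = f (state r (take j H))"
      using nth_match[of k H] k HK by metis
    obtain l where l: "l < length G" "G ! l = (?\<sigma> ! k, Match)" "num_matches (take l G) = k"
      "match_costs r f G ! k = f (state r (take l G))"
      using nth_match[of k G] k G(2) by metis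
    have "integral {(0 # ?\<tau>) ! k..?\<tau> ! k} (rate_at c r (take j H @ drop j H)) =
          integral {(0 # ?\<tau>) ! k..?\<tau> ! k} (rate_at c r (take j H))"
      by (rule integral_rate_at_append) (use H(1) j in \<open>auto simp: hd_drop_conv_nth\<close>)
    then have W: "W k = integral {last_match_time (take j H)..?\<tau> ! k} (rate_at c r (take j H))"
      using j(3) by (simp add: W_def last_match_time_take)
    have a: "match_costs r f H ! k \<le> \<alpha> * W k"
      using CB_match(1)[OF \<alpha> c r f exec j(1,2)] j(4) W by simp
    have y: "state r (take l G) \<in> feasible_states r"
      using G'(2) l(1,2) by (auto simp: matches_feasible_def)
    then have pos: "0 < match_costs r f G ! k"
      using f l(4) by (auto simp: matching_cost_def)
    have grow: "0 \<le> A (min (?\<tau> ! k) ?T) - A (min ((0 # ?\<tau>) ! k) ?T)"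
      using A_mono[of "min ((0 # ?\<tau>) ! k) ?T" "min (?\<tau> ! k) ?T"] \<tau>_nonneg[of k] \<tau>_mono[OF k] T_nonneg k
      by auto
    show ?thesis
    proof (cases "?\<tau> ! k \<le> ?\<sigma> ! k")
      case True
      \<comment> \<open>CB matches no later than the offline policy: the offline waiting in the same
        period pays, with factor 1 + \<alpha>. The cut-off is inactive here.\<close>
      then have "W k \<le> integral {(0 # ?\<tau>) ! k..?\<tau> ! k} (rate_at c r G)"
        unfolding W_def using k HK G(2) by (intro wait_le_later_matches c G' H) (simp_all add: G' H)
      also have "\<dots> = A (?\<tau> ! k) - A ((0 # ?\<tau>) ! k)"
        using integral_rate_at_split[OF G'(1) \<tau>_nonneg \<tau>_mono[OF k], of c r] k by (simp add: A_def)
      also have "\<dots> = A (min (?\<tau> ! k) ?T) - A (min ((0 # ?\<tau>) ! k) ?T)"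
        using True \<sigma>_le[OF k] \<tau>_mono[OF k] by (simp add: min_def)
      finally have le: "W k \<le> A (min (?\<tau> ! k) ?T) - A (min ((0 # ?\<tau>) ! k) ?T)" .
      have "W k + match_costs r f H ! k \<le> (1 + \<alpha>) * W k"
        using a by (simp add: algebra_simps)
      also have "\<dots> \<le> (1 + \<alpha>) *
          (match_costs r f G ! k + (A (min (?\<tau> ! k) ?T) - A (min ((0 # ?\<tau>) ! k) ?T)))"
        using le pos \<alpha> by (intro mult_left_mono) auto
      also have "\<dots> \<le> ?C *
          (match_costs r f G ! k + (A (min (?\<tau> ! k) ?T) - A (min ((0 # ?\<tau>) ! k) ?T)))"
        using grow pos by (intro mult_right_mono) auto
      finally show ?thesis .
    next
      case False
      \<comment> \<open>The offline policy matched first: its matching cost pays, with factor 1 + 1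
        / \<alpha>. Its pre-match state and the arrivals before it serve as \<open>y\<close> and
        \<open>P\<close>.\<close>
      have "\<alpha> * W k \<le> f (state r (take l G))"
        unfolding W
      proof (rule CB_match(2)[OF \<alpha> c r f exec j(1,2) y])
        show "?\<sigma> ! k < ?\<tau> ! k"
          using False by simp
        show "arrivals_of (take l G) @ arrivals_of (drop l G) = arr"
          using G'(3) by (metis append_take_drop_id arrivals_of_simps(2))
        have "chronological (take l G @ [(?\<sigma> ! k, Match)])"
          using chronological_take[OF G'(1), of "Suc l"] l by (simp add: take_Suc_conv_app_nth)
        then show "fst p \<le> ?\<sigma> ! k" if "p \<in> set (arrivals_of (take l G))" for p
          using that le_now[of "take l G"]
          by (fastforce simp: arrivals_of_def split: event.splits)
        show "state r (take l G) i + num_matches (take j H) * r i = arrived (take l G) i" for i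
          using state_balance[OF matches_feasible_take[OF G'(2)], of l i] l(3) j(3) by simp
      qed
      then have b: "\<alpha> * W k \<le> match_costs r f G ! k"
        using l(4) by simp
      have "W k + match_costs r f H ! k \<le> (1 + 1 / \<alpha>) * (\<alpha> * W k)"
        using a \<alpha> by (simp add: algebra_simps)
      also have "\<dots> \<le> (1 + 1 / \<alpha>) *
          (match_costs r f G ! k + (A (min (?\<tau> ! k) ?T) - A (min ((0 # ?\<tau>) ! k) ?T)))"
        using b grow \<alpha> by (intro mult_left_mono) auto
      also have "\<dots> \<le> ?C *
          (match_costs r f G ! k + (A (min (?\<tau> ! k) ?T) - A (min ((0 # ?\<tau>) ! k) ?T)))"
        using grow pos by (intro mult_right_mono) auto
      finally show ?thesis .
    qed
  qed
  have "integral {0..last_match_time H} (rate_at c r H) = (\<Sum>k<K. W k)"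
  proof -
    have "W k = integral {0..(0 # ?\<tau>) ! Suc k} (rate_at c r H) - integral {0..(0 # ?\<tau>) ! k} (rate_at c r H)"
      if "k < K" for k
      using integral_rate_at_split[OF H(1) \<tau>_nonneg \<tau>_mono, of k c r] that by (simp add: W_def)
    then have "(\<Sum>k<K. W k) = (\<Sum>k<K. integral {0..(0 # ?\<tau>) ! Suc k} (rate_at c r H) -
        integral {0..(0 # ?\<tau>) ! k} (rate_at c r H))"
      by simp
    also have "\<dots> = integral {0..(0 # ?\<tau>) ! K} (rate_at c r H)"
      by (subst sum_lessThan_telescope) simp
    finally show ?thesis
      by (simp add: last_match_time_nth HK)
  qed
  then have "integral {0..last_match_time H} (rate_at c r H) + sum_list (match_costs r f H) =
      (\<Sum>k<K. W k + match_costs r f H ! k)"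
    by (simp add: sum.distrib sum_list_sum_nth HK atLeast0LessThan)
  also have "\<dots> \<le> (\<Sum>k<K. ?C * (match_costs r f G ! k +
      (A (min ((0 # ?\<tau>) ! Suc k) ?T) - A (min ((0 # ?\<tau>) ! k) ?T))))"
    using per_match by (intro sum_mono) simp
  also have "\<dots> = ?C * (sum_list (match_costs r f G) +
      (\<Sum>k<K. A (min ((0 # ?\<tau>) ! Suc k) ?T) - A (min ((0 # ?\<tau>) ! k) ?T)))"
    by (simp only: sum_distrib_left[symmetric] sum.distrib sum_list_sum_nth length_match_costs
        G(2) atLeast0LessThan)
  also have "(\<Sum>k<K. A (min ((0 # ?\<tau>) ! Suc k) ?T) - A (min ((0 # ?\<tau>) ! k) ?T)) =
      A (min ((0 # ?\<tau>) ! K) ?T)"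
    using T_nonneg by (subst sum_lessThan_telescope) (simp add: A_def)
  \<comment> \<open>If CB finishes before the offline policy, the remaining offline waiting is not
    charged at all.\<close>
  also have "?C * (sum_list (match_costs r f G) + A (min ((0 # ?\<tau>) ! K) ?T)) \<le>
      ?C * (sum_list (match_costs r f G) + A ?T)"
    using A_mono[of "min ((0 # ?\<tau>) ! K) ?T" ?T] \<tau>_nonneg[of K] T_nonneg \<alpha>
    by (intro mult_left_mono add_left_mono) (auto simp: max_def)
  finally show ?thesis
    using HK G(2) by (simp add: policy_cost_def total_cost_eq H_def[symmetric] A_def add.commute)
qed

lemma CB_competitive:
  assumes "0 < \<alpha>" "\<And>i. 0 < c i" "\<And>i. 1 \<le> r i" "matching_cost r f" "balanced r K arr"
  shows "policy_cost c r f K arr (CB \<alpha> c r f) \<le> ereal (1 + max \<alpha> (1 / \<alpha>)) * opt_cost c r f K arr"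
proof -
  have C: "0 < ereal (1 + max \<alpha> (1 / \<alpha>))"
    using assms(1) by (simp add: max_def)
  have "policy_cost c r f K arr (CB \<alpha> c r f) \<le> ereal (1 + max \<alpha> (1 / \<alpha>)) * total_cost c r f K G"
    if "feasible_history r arr G" for G
  proof (cases "num_matches G = K")
    case True
    then show ?thesis
      using CB_le_offline[OF assms that] by simp
  next
    case False
    then show ?thesis
      using C by (simp add: total_cost_eq)
  qed
  \<comment> \<open>The positive constant is moved to the other side in order to pass to the
    infimum, and moved back afterwards.\<close>
  then have "policy_cost c r f K arr (CB \<alpha> c r f) / ereal (1 + max \<alpha> (1 / \<alpha>)) \<le> opt_cost c r f K arr"
    unfolding opt_cost_def using C by (intro INF_greatest) (simp add: ereal_divide_le_pos)
  then show ?thesis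
    using C by (simp add: ereal_divide_le_pos)
qed

section \<open>The lower bound\<close>

abbreviation batch :: "'n list \<Rightarrow> real \<Rightarrow> 'n history" where
  "batch L s \<equiv> map (\<lambda>i. (s, Arrival i)) L"

lemma batch_simps [simp]:
  "arrivals_of (batch L s) = map (Pair s) L"
  "match_times (batch L s) = []"
  by (induction L) (auto simp: arrivals_of_def match_times_def)

lemma state_batch: "state r (h @ batch L s) = (\<lambda>i. state r h i + count_list L i)"
  by (induction L arbitrary: h rule: rev_induct) (auto simp flip: append_assoc)

lemma now_batch: "L \<noteq> [] \<Longrightarrow> now (h @ batch L s) = s"
  by (simp add: now_def last_map)

lemma chronological_batch:
  "chronological h \<Longrightarrow> now h \<le> s \<Longrightarrow> chronological (h @ batch L s)"
  by (auto simp: chronological_append o_def map_replicate_const)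

lemma matches_feasible_batch [simp]: "matches_feasible r (h @ batch L s) \<longleftrightarrow> matches_feasible r h"
  by (induction L rule: rev_induct) (auto simp flip: append_assoc)

lemma match_costs_batch [simp]: "match_costs r f (h @ batch L s) = match_costs r f h"
  by (induction L rule: rev_induct) (auto simp flip: append_assoc)

text \<open>In contrast to \<open>total_cost\<close>, waiting is counted up to the last event; the
  two agree once the last event is the final match.\<close>

definition cost_so_far :: "('n::finite \<Rightarrow> real) \<Rightarrow> 'n state \<Rightarrow> ('n state \<Rightarrow> real) \<Rightarrow> 'n history \<Rightarrow> real" where
  "cost_so_far c r f h = integral {0..now h} (rate_at c r h) + sum_list (match_costs r f h)"

lemma integral_rate_at_snoc:
  assumes "chronological h" "now h \<le> s"
  shows "integral {0..s} (rate_at c r (h @ [(s, e)])) =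
         integral {0..now h} (rate_at c r h) + (s - now h) * wait_rate c (state r h)"
  using integral_rate_at_append[of h "[(s, e)]" s 0 c r] assms
    integral_rate_at_split[OF assms(1) now_nonneg[OF assms(1)] assms(2), of c r]
    integral_rate_at_now[OF assms, of c r] by simp

lemma cost_so_far_match:
  assumes "chronological h" "now h \<le> s"
  shows "cost_so_far c r f (h @ [(s, Match)]) =
         cost_so_far c r f h + (s - now h) * wait_rate c (state r h) + f (state r h)"
  using integral_rate_at_snoc[OF assms] by (simp add: cost_so_far_def)

lemma cost_so_far_batch:
  assumes "chronological h" "now h \<le> s" "L \<noteq> []"
  shows "cost_so_far c r f (h @ batch L s) = cost_so_far c r f h + (s - now h) * wait_rate c (state r h)"
  using assms(3)
proof (induction L rule: rev_nonempty_induct)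
  case (single i)
  then show ?case
    using integral_rate_at_snoc[OF assms(1,2)] by (simp add: cost_so_far_def)
next
  case (snoc i L)
  then show ?case
    using integral_rate_at_snoc[OF chronological_batch[OF assms(1,2)], of L s c r "Arrival i"]
    by (simp add: cost_so_far_def now_batch flip: append_assoc)
qed

lemma total_cost_last_match:
  "num_matches h + 1 = K \<Longrightarrow>
   total_cost c r f K (h @ [(t, Match)]) = ereal (cost_so_far c r f (h @ [(t, Match)]))"
  by (simp add: total_cost_eq cost_so_far_def)

lemma opt_cost_nonneg:
  assumes "\<And>i. 0 < c i" "matching_cost r f"
  shows "0 \<le> opt_cost c r f K arr"
  unfolding opt_cost_def
proof (rule INF_greatest)
  fix h assume "h \<in> {h. feasible_history r arr h}"
  then have h: "chronological h" "matches_feasible r h"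
    by (auto simp: feasible_history_iff)
  have "0 \<le> sum_list (match_costs r f h)"
    using h(2) assms(2)
    by (intro sum_list_nonneg) (auto simp: match_costs_def matches_feasible_def matching_cost_def less_imp_le)
  then show "0 \<le> total_cost c r f K h"
    using integral_rate_at_nonneg[OF assms(1) h(1)] by (simp add: total_cost_eq)
qed

section \<open>The adversary and its instances\<close>

definition cheap_unless_equal :: "'n state \<Rightarrow> real \<Rightarrow> 'n state \<Rightarrow> real" where
  "cheap_unless_equal r \<epsilon> x = (if x = r then 1 else \<epsilon>)"

text \<open>\<open>r\<close> is the least feasible state, so a higher cost at \<open>r\<close> alone
  respects monotonicity.\<close>

lemma matching_cost_cheap_unless_equal:
  "0 < \<epsilon> \<Longrightarrow> \<epsilon> \<le> 1 \<Longrightarrow> matching_cost r (cheap_unless_equal r \<epsilon>)"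
  by (auto simp: matching_cost_def monotone_on_def cheap_unless_equal_def feasible_states_def le_fun_def
      intro!: ext antisym)

text \<open>The value at \<open>Wait\<close> is a default: a play is compared with a run only up to
  the first \<open>Wait\<close>.\<close>

fun delay :: "decision \<Rightarrow> real" where
  "delay Wait = 0"
| "delay (Timer y d) = d"

text \<open>
  The adversary sends batches of \<open>r\<close> agents, each a moment \<open>\<delta>\<close> after the policy has matched the
  previous batch: had the policy waited a little longer, the match would have been almost free.
\<close>

primrec play :: "'n policy \<Rightarrow> 'n list \<Rightarrow> real \<Rightarrow> nat \<Rightarrow> 'n history" where
  "play \<pi> L \<delta> 0 = batch L 0"
| "play \<pi> L \<delta> (Suc k) =
     (play \<pi> L \<delta> k @ [(now (play \<pi> L \<delta> k) + delay (\<pi> (play \<pi> L \<delta> k)), Match)])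
       @ batch L (now (play \<pi> L \<delta> k) + delay (\<pi> (play \<pi> L \<delta> k)) + \<delta>)"

text \<open>\<delta> is scaled so that keeping \<open>r\<close> agents waiting for the extra moment
  costs exactly \<epsilon>.\<close>

locale adversary =
  fixes c :: "'n::finite \<Rightarrow> real" and r :: "'n state" and \<pi> :: "'n policy"
    and L :: "'n list" and \<delta> \<epsilon> :: real
  assumes c: "\<And>i. 0 < c i" and r: "\<And>i. 1 \<le> r i"
    and L: "\<And>i. count_list L i = r i"
    and online: "online_policy r \<pi>"
    and \<delta>: "0 < \<delta>" and \<epsilon>: "0 < \<epsilon>" "\<epsilon> \<le> 1" and \<delta>_\<epsilon>: "\<delta> * wait_rate c r = \<epsilon>"
begin

abbreviation "H \<equiv> play \<pi> L \<delta>"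
abbreviation "d k \<equiv> delay (\<pi> (H k))"
abbreviation "f \<equiv> cheap_unless_equal r \<epsilon>"
abbreviation "w \<equiv> wait_rate c r"

lemma L_nonempty: "L \<noteq> []"
  using L r by (metis count_list.simps(1) not_one_le_zero)

lemma delay_nonneg: "0 \<le> delay (\<pi> h)"
  using online by (cases "\<pi> h") (auto simp: online_policy_def)

lemma infeasible_Wait: "state r h \<notin> feasible_states r \<Longrightarrow> \<pi> h = Wait"
  using online by (cases "\<pi> h") (auto simp: online_policy_def)

lemma r_feasible: "r \<in> feasible_states r" and zero_infeasible: "(\<lambda>_. 0) \<notin> feasible_states r"
  using r by (auto simp: feasible_states_def Suc_le_eq)

lemma f_r: "f r = 1"
  by (simp add: cheap_unless_equal_def)

lemma wait_rate_zero: "wait_rate c (\<lambda>_. 0) = 0"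
  by (simp add: wait_rate_def)

text \<open>In each round the policy waits in state \<open>r\<close> and matches there at cost 1; in
  the gap \<delta> the system is empty and waiting is free.\<close>

lemma play_properties:
  "state r (H k) = r \<and> chronological (H k) \<and> matches_feasible r (H k) \<and> num_matches (H k) = k \<and>
   cost_so_far c r f (H k) = (\<Sum>l<k. 1 + d l * w)"
proof (induction k)
  case 0
  show ?case
    using state_batch[of r "[]" 0 L] chronological_batch[of "[]" 0 L] cost_so_far_batch[of "[]" 0 L c r f]
      matches_feasible_batch[of r "[]" 0 L]
    by (simp add: L L_nonempty cost_so_far_def)
next
  case (Suc k)
  let ?t = "now (H k) + d k"
  let ?g = "H k @ [(?t, Match)]"
  have g: "chronological ?g" "state r ?g = (\<lambda>_. 0)" "matches_feasible r ?g"
    using Suc r_feasible delay_nonneg by auto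
  have "cost_so_far c r f ?g = (\<Sum>l<Suc k. 1 + d l * w)"
    using Suc delay_nonneg[of "H k"]
    by (subst cost_so_far_match) (auto simp: f_r)
  then have "cost_so_far c r f (H (Suc k)) = (\<Sum>l<Suc k. 1 + d l * w)"
    unfolding play.simps using g(2) \<delta> wait_rate_zero
    by (subst cost_so_far_batch[OF g(1)]) (auto simp: L_nonempty)
  then show ?case
    using Suc g \<delta> chronological_batch[OF g(1), of "?t + \<delta>" L]
    by (simp add: state_batch L del: append_assoc)
qed

lemma length_L: "1 \<le> length L"
  using L_nonempty by (simp add: Suc_le_eq)

text \<open>Rounds are counted from 0: \<open>H k\<close> contains \<open>k + 1\<close> batches but
  only \<open>k\<close> matches, the last batch being still unmatched.\<close>

lemma balanced_play: "balanced r (Suc k) (arrivals_of (H k))"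
proof -
  have "chronological (H k)"
    using play_properties by blast
  then have "sorted (0 # map fst (arrivals_of (H k)))"
    unfolding chronological_def map_fst_arrivals_of by (auto intro: sorted_filter)
  then show ?thesis
    using state_balance[of r "H k"] play_properties[of k] by (auto simp: balanced_def)
qed

text \<open>Within an incomplete batch the type of the next agent is still short, so the policy can
  only wait.\<close>

lemma batch_steps:
  assumes "state r h = (\<lambda>_. 0)" "n \<le> length L"
  shows "(step \<pi> ^^ n) (h, map (Pair s) L @ rest) =
         (h @ batch (take n L) s, map (Pair s) (drop n L) @ rest)"
  using assms(2)
proof (induction n)
  case (Suc n)
  let ?h = "h @ batch (take n L) s"
  have "count_list L (L ! n) = count_list (take n L) (L ! n) + count_list (drop n L) (L ! n)"
    by (metis append_take_drop_id count_list_append)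
  moreover have "drop n L = L ! n # drop (Suc n) L"
    using Suc.prems by (simp add: Cons_nth_drop_Suc)
  ultimately have "state r ?h (L ! n) < r (L ! n)"
    using L[of "L ! n"] assms(1) by (simp add: state_batch)
  then have "\<pi> ?h = Wait"
    by (intro infeasible_Wait) (auto simp: feasible_states_def not_le)
  then show ?case
    using Suc by (simp add: step_def take_Suc_conv_app_nth flip: Cons_nth_drop_Suc)
qed simp

text \<open>One step per event: \<open>k + 1\<close> batches and \<open>k\<close> matches. As
  \<delta> is positive, each timer expires before the next batch.\<close>

lemma play_steps:
  "(\<And>l. l < k \<Longrightarrow> \<pi> (H l) \<noteq> Wait) \<Longrightarrow>
   (step \<pi> ^^ (k * (length L + 1) + length L)) ([], arrivals_of (H k) @ rest) = (H k, rest)"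
proof (induction k arbitrary: rest)
  case 0
  then show ?case
    using batch_steps[of "[]" "length L" 0 rest] by simp
next
  case (Suc k)
  let ?t = "now (H k) + d k"
  let ?rest = "map (Pair (?t + \<delta>)) L @ rest"
  let ?g = "H k @ [(?t, Match)]"
  obtain y x where y: "\<pi> (H k) = Timer y x"
    using Suc.prems[of k] by (cases "\<pi> (H k)") auto
  have match: "step \<pi> (H k, ?rest) = (?g, ?rest)"
    using y L_nonempty \<delta> by (auto simp: step_def Let_def hd_map)
  have "state r ?g = (\<lambda>_. 0)"
    using play_properties[of k] by simp
  then have batch: "(step \<pi> ^^ length L) (?g, ?rest) = (H (Suc k), rest)"
    using batch_steps[of ?g "length L" "?t + \<delta>" rest] by simp
  have "Suc k * (length L + 1) + length L = length L + (1 + (k * (length L + 1) + length L))"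
    by simp
  moreover have "arrivals_of (H (Suc k)) @ rest = arrivals_of (H k) @ ?rest"
    by simp
  ultimately show ?case
    using Suc match batch by (simp only: funpow_add o_apply) simp
qed

lemma length_play: "length (arrivals_of (H k)) = Suc k * length L"
  by (induction k) auto

text \<open>The step budget of \<open>run\<close> covers the play and one further step; the surplus
  steps change nothing.\<close>

lemma run_play_aux:
  assumes "\<And>l. l < k \<Longrightarrow> \<pi> (H l) \<noteq> Wait" "step \<pi> (H k, []) = (g, [])" "step \<pi> (g, []) = (g, [])"
  shows "run \<pi> (arrivals_of (H k)) = g"
proof -
  have "2 * length (arrivals_of (H k)) = 2 * length L + 2 * (k * length L)"
    and "k * (length L + 1) = k * length L + k" and "k \<le> k * length L"
    using length_L by (simp_all add: length_play)
  then have "k * (length L + 1) + length L + 1 \<le> 2 * length (arrivals_of (H k))"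
    using length_L by linarith
  then obtain m where m: "2 * length (arrivals_of (H k)) = m + (1 + (k * (length L + 1) + length L))"
    by (metis add.commute le_iff_add)
  have "(step \<pi> ^^ m) (g, []) = (g, [])"
    using assms(3) by (induction m) auto
  then show ?thesis
    using play_steps[of k "[]"] assms(1,2) unfolding run_def m funpow_add by simp
qed

lemma run_play_Wait:
  assumes "\<And>l. l < k \<Longrightarrow> \<pi> (H l) \<noteq> Wait" "\<pi> (H k) = Wait"
  shows "run \<pi> (arrivals_of (H k)) = H k"
  using assms by (intro run_play_aux) (auto simp: step_def)

lemma run_play_Timer:
  assumes "\<And>l. \<pi> (H l) \<noteq> Wait"
  shows "run \<pi> (arrivals_of (H k)) = H k @ [(now (H k) + d k, Match)]"
proof (rule run_play_aux)
  obtain y x where "\<pi> (H k) = Timer y x"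
    using assms[of k] by (cases "\<pi> (H k)") auto
  then show "step \<pi> (H k, []) = (H k @ [(now (H k) + d k, Match)], [])"
    by (simp add: step_def)
  have "\<pi> (H k @ [(now (H k) + d k, Match)]) = Wait"
    using play_properties[of k] zero_infeasible by (intro infeasible_Wait) simp
  then show "step \<pi> (H k @ [(now (H k) + d k, Match)], []) = (H k @ [(now (H k) + d k, Match)], [])"
    by (simp add: step_def)
qed (use assms in auto)

text \<open>
  Matching at once and matching right after the next batch lead to the same state, so in every round
  the cheaper option can be chosen.
\<close>

lemma offline_history:
  "\<exists>g. chronological g \<and> matches_feasible r g \<and> arrivals_of g = arrivals_of (H k) \<and>
     now g = now (H k) \<and> state r g = r \<and> num_matches g = k \<and>
     cost_so_far c r f g = (\<Sum>l<k. min 1 (d l * w + 2 * \<epsilon>))"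
proof (induction k)
  case 0
  show ?case
    using play_properties[of 0] by (intro exI[of _ "H 0"]) simp
next
  case (Suc k)
  then obtain g where g: "chronological g" "matches_feasible r g" "arrivals_of g = arrivals_of (H k)"
    "now g = now (H k)" "state r g = r" "num_matches g = k"
    "cost_so_far c r f g = (\<Sum>l<k. min 1 (d l * w + 2 * \<epsilon>))"
    by blast
  let ?s = "now (H k) + d k + \<delta>"
  have s: "now g \<le> ?s"
    using g(4) \<delta> delay_nonneg[of "H k"] by simp
  have now_Suc: "now (H (Suc k)) = ?s"
    by (simp add: now_batch L_nonempty del: append_assoc)
  have arr: "arrivals_of (H (Suc k)) = arrivals_of g @ map (Pair ?s) L"
    using g(3) by simp
  show ?case
  proof (cases "1 \<le> d k * w + 2 * \<epsilon>")
    case True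
    let ?g = "g @ [(now g, Match)]"
    have g': "chronological ?g" "state r ?g = (\<lambda>_. 0)" "matches_feasible r ?g" "now ?g \<le> ?s"
      using g r_feasible s by auto
    have "cost_so_far c r f (?g @ batch L ?s) = cost_so_far c r f ?g"
      using cost_so_far_batch[OF g'(1,4) L_nonempty, of c r f] g'(2) wait_rate_zero by simp
    also have "\<dots> = (\<Sum>l<Suc k. min 1 (d l * w + 2 * \<epsilon>))"
      using g True by (simp add: cost_so_far_match f_r)
    finally have "cost_so_far c r f (?g @ batch L ?s) = (\<Sum>l<Suc k. min 1 (d l * w + 2 * \<epsilon>))" .
    then show ?thesis
      using g g' chronological_batch[OF g'(1,4), of L] now_Suc arr
      by (intro exI[of _ "?g @ batch L ?s"])
         (simp add: state_batch L now_batch L_nonempty del: append_assoc play.simps)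
  next
    case False
    let ?g = "g @ batch L ?s"
    have state: "state r ?g = (\<lambda>i. r i + r i)" "now ?g = ?s"
      using g(5) by (simp_all add: state_batch L now_batch L_nonempty)
    have g': "chronological ?g" "matches_feasible r ?g"
      using g chronological_batch[OF g(1) s] by auto
    \<comment> \<open>After the next batch the state differs from \<open>r\<close>, so the match
      costs only \<epsilon>. Together with the extra waiting during \<delta> this gives the term
      \<open>2 * \<epsilon>\<close>.\<close>
    have "(\<lambda>i. r i + r i) \<noteq> r"
      using r by (metis add_cancel_right_right not_one_le_zero)
    then have "cost_so_far c r f (?g @ [(?s, Match)]) = cost_so_far c r f g + (d k + \<delta>) * w + \<epsilon>"
      using cost_so_far_match[OF g'(1), of ?s c r f] cost_so_far_batch[OF g(1) s L_nonempty, of c r f]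
        state g(4,5)
      by (simp add: cheap_unless_equal_def del: append_assoc)
    also have "\<dots> = (\<Sum>l<Suc k. min 1 (d l * w + 2 * \<epsilon>))"
      using False \<delta>_\<epsilon> g(7) by (simp add: algebra_simps)
    finally show ?thesis
      using g g' state now_Suc arr
      by (intro exI[of _ "?g @ [(?s, Match)]"])
         (simp add: feasible_states_def del: append_assoc play.simps)
  qed
qed

text \<open>No batch follows the last one, so the offline history makes its final match in state
  \<open>r\<close> at cost 1.\<close>

lemma opt_cost_le:
  "opt_cost c r f (Suc k) (arrivals_of (H k)) \<le> ereal ((\<Sum>l<k. min 1 (d l * w + 2 * \<epsilon>)) + 1)"
proof -
  obtain g where g: "chronological g" "matches_feasible r g" "arrivals_of g = arrivals_of (H k)"
    "state r g = r" "num_matches g = k" "cost_so_far c r f g = (\<Sum>l<k. min 1 (d l * w + 2 * \<epsilon>))"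
    using offline_history by blast
  have "opt_cost c r f (Suc k) (arrivals_of (H k)) \<le> total_cost c r f (Suc k) (g @ [(now g, Match)])"
    unfolding opt_cost_def using g r_feasible
    by (intro INF_lower) (auto simp: feasible_history_iff)
  also have "\<dots> = ereal ((\<Sum>l<k. min 1 (d l * w + 2 * \<epsilon>)) + 1)"
    using g by (subst total_cost_last_match) (auto simp: cost_so_far_match f_r)
  finally show ?thesis .
qed

lemma policy_cost_Wait:
  assumes "\<And>l. l < k \<Longrightarrow> \<pi> (H l) \<noteq> Wait" "\<pi> (H k) = Wait"
  shows "policy_cost c r f (Suc k) (arrivals_of (H k)) \<pi> = \<infinity>"
proof -
  have "run \<pi> (arrivals_of (H k)) = H k"
    by (rule run_play_Wait) (use assms in auto)
  then show ?thesis
    using play_properties[of k] by (simp add: policy_cost_def total_cost_eq)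
qed

lemma policy_cost_Timer:
  assumes "\<And>l. \<pi> (H l) \<noteq> Wait"
  shows "policy_cost c r f (Suc k) (arrivals_of (H k)) \<pi> = ereal ((\<Sum>l<k. 1 + d l * w) + d k * w + 1)"
  unfolding policy_cost_def run_play_Timer[OF assms]
  using play_properties[of k] delay_nonneg[of "H k"]
  by (subst total_cost_last_match) (auto simp: cost_so_far_match f_r)

end

section \<open>The ratio\<close>

text \<open>If \<open>z = 0\<close>, the quotient is infinite because \<open>p\<close> is positive,
  so no positive lower bound on the offline optimum is required.\<close>

lemma ereal_ratio_ge:
  assumes "0 \<le> z" "z \<le> ereal u" "a * u \<le> p" "0 < p"
  shows "ereal a \<le> ereal p / z"
proof -
  obtain o' where o': "z = ereal o'" "0 \<le> o'" "o' \<le> u"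
    using assms(1,2) by (cases z) auto
  show ?thesis
  proof (cases "o' = 0")
    case True
    then show ?thesis
      using o' assms(4) by (simp add: divide_ereal_def)
  next
    case False
    have "a * o' \<le> p"
    proof (cases "0 \<le> a")
      case True
      then show ?thesis
        using assms(3) mult_left_mono[OF o'(3) True] by linarith
    next
      case False
      then show ?thesis
        using assms(4) mult_nonpos_nonneg[of a o'] o'(2) by linarith
    qed
    then show ?thesis
      using False o' by (simp add: field_simps)
  qed
qed

text \<open>On a finite type every function to the naturals counts some multiset; any enumeration of
  it serves as a batch.\<close>

lemma ex_list_counts: "\<exists>L. \<forall>i::'n::finite. count_list L i = r i"
proof -
  obtain L where "mset L = Abs_multiset r"
    using ex_mset by blast
  then have "count (mset L) = r"
    by simp
  then show ?thesis
    by (metis count_mset)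
qed

lemma round_ratio:
  fixes x \<epsilon> :: real
  assumes "0 \<le> x" "0 < \<epsilon>" "\<epsilon> \<le> 1 / 4"
  shows "(2 - 4 * \<epsilon>) * min 1 (x + 2 * \<epsilon>) \<le> 1 + x"
proof (cases "1 \<le> x + 2 * \<epsilon>")
  case True
  then show ?thesis
    using assms by simp
next
  case False
  \<comment> \<open>The factor \<open>2 - 4 * \<epsilon>\<close> is split as
    \<open>1 + (1 - 4 * \<epsilon>)\<close>; the two parts contribute at most
    \<open>x + 2 * \<epsilon>\<close> and \<open>1 - 4 * \<epsilon>\<close>.\<close>
  have "(1 - 4 * \<epsilon>) * (x + 2 * \<epsilon>) \<le> (1 - 4 * \<epsilon>) * 1"
    using False assms by (intro mult_left_mono) auto
  then show ?thesis
    using False assms by (simp add: algebra_simps)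
qed

text \<open>The policy may know the cost function. This function is therefore fixed first, from
  \<open>r\<close> and \<eta> alone, and only the arrivals react to \<open>\<pi> f\<close>.\<close>

lemma no_policy_better_than_2:
  fixes c :: "'n::finite \<Rightarrow> real" and r :: "'n state"
  assumes c: "\<And>i. 0 < c i" and r: "\<And>i. 1 \<le> r i" and \<eta>: "0 < \<eta>"
    and online: "\<And>f. matching_cost r f \<Longrightarrow> online_policy r (\<pi> f)"
  shows "\<exists>f K arr. matching_cost r f \<and> 0 < K \<and> balanced r K arr \<and>
           ereal (2 - \<eta>) \<le> policy_cost c r f K arr (\<pi> f) / opt_cost c r f K arr"
proof -
  \<comment> \<open>The loss \<open>4 * \<epsilon>\<close> per round uses at most half of \<eta>;
    the other half is reserved for the expensive last match.\<close>
  define \<epsilon> where "\<epsilon> = min (1 / 4) (\<eta> / 8)"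
  have small: "0 < \<epsilon>" "\<epsilon> \<le> 1 / 4" "4 * \<epsilon> \<le> \<eta> / 2"
    using \<eta> by (auto simp: \<epsilon>_def)
  let ?f = "cheap_unless_equal r \<epsilon>"
  have f: "matching_cost r ?f"
    using small by (intro matching_cost_cheap_unless_equal) auto
  obtain L where L: "\<And>i. count_list L i = r i"
    using ex_list_counts by blast
  have w: "0 < wait_rate c r"
    using c r by (rule wait_rate_pos)
  interpret adversary c r "\<pi> ?f" L "\<epsilon> / wait_rate c r" \<epsilon>
    by unfold_locales (use c r L online[OF f] small w in auto)
  have opt_nonneg: "0 \<le> opt_cost c r ?f K arr" for K arr
    by (rule opt_cost_nonneg) (use c f in auto)
  show ?thesis
  proof (cases "\<exists>k. \<pi> ?f (H k) = Wait")
    case True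
    \<comment> \<open>At the first \<open>Wait\<close> all earlier rounds were played with timers,
      so the run follows the play up to this batch.\<close>
    define k where "k = (LEAST k. \<pi> ?f (H k) = Wait)"
    have k: "\<pi> ?f (H k) = Wait" "\<And>l. l < k \<Longrightarrow> \<pi> ?f (H l) \<noteq> Wait"
      unfolding k_def using LeastI_ex[OF True] not_less_Least by blast+
    have "policy_cost c r ?f (Suc k) (arrivals_of (H k)) (\<pi> ?f) = \<infinity>"
      by (rule policy_cost_Wait) (use k in auto)
    then have "policy_cost c r ?f (Suc k) (arrivals_of (H k)) (\<pi> ?f) /
        opt_cost c r ?f (Suc k) (arrivals_of (H k)) = \<infinity>"
      using opt_cost_le[of k] opt_nonneg[of "Suc k" "arrivals_of (H k)"]
      by (cases "opt_cost c r ?f (Suc k) (arrivals_of (H k))") (auto simp: divide_ereal_def)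
    then show ?thesis
      using f balanced_play[of k] by (intro exI[of _ ?f] exI[of _ "Suc k"] exI[of _ "arrivals_of (H k)"]) auto
  next
    case False
    then have timer: "\<And>k. \<pi> ?f (H k) \<noteq> Wait"
      by blast
    \<comment> \<open>Each round contributes at least \<open>2 * \<epsilon>\<close> to the offline
      bound \<open>M\<close>, so with this many rounds \<open>\<eta> / 2 * M\<close> is at least 1
      and absorbs the last match.\<close>
    obtain k :: nat where k: "2 / \<eta> \<le> k * (2 * \<epsilon>)"
      using ex_less_of_nat_mult[of "2 * \<epsilon>" "2 / \<eta>"] small(1) less_imp_le by auto
    have x: "0 \<le> d l * w" for l
      using delay_nonneg[of "H l"] w by simp
    define M where "M = (\<Sum>l<k. min 1 (d l * w + 2 * \<epsilon>))"
    define P where "P = (\<Sum>l<k. 1 + d l * w)"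
    have "(\<Sum>l<k. 2 * \<epsilon>) \<le> M"
      unfolding M_def using x small by (intro sum_mono) auto
    then have "2 / \<eta> \<le> M"
      using k by simp
    then have "2 \<le> \<eta> * M" and M: "0 \<le> M"
      using \<eta> by (simp add: field_simps, smt (verit) divide_pos_pos)
    have "(2 - 4 * \<epsilon>) * M \<le> P"
      unfolding M_def P_def sum_distrib_left using x small by (intro sum_mono round_ratio) auto
    moreover have "4 * \<epsilon> * M \<le> \<eta> / 2 * M"
      using small(3) M by (rule mult_right_mono)
    ultimately have "(2 - \<eta>) * (M + 1) \<le> P + d k * w + 1"
      using \<open>2 \<le> \<eta> * M\<close> x[of k] \<eta> by (simp add: algebra_simps)
    moreover have "0 \<le> P"
      unfolding P_def using x by (intro sum_nonneg) (simp add: add_nonneg_nonneg)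
    ultimately have "ereal (2 - \<eta>) \<le> ereal (P + d k * w + 1) / opt_cost c r ?f (Suc k) (arrivals_of (H k))"
      using opt_cost_le[of k] opt_nonneg x[of k] unfolding M_def[symmetric]
      by (intro ereal_ratio_ge[where u = "M + 1"]) auto
    then show ?thesis
      using f balanced_play[of k] policy_cost_Timer[OF timer, of k] unfolding P_def
      by (intro exI[of _ ?f] exI[of _ "Suc k"] exI[of _ "arrivals_of (H k)"]) auto
  qed
qed

theorem proposition6:
  fixes c :: "'n::finite \<Rightarrow> real" and r :: "'n \<Rightarrow> nat"
  assumes "2 \<le> CARD('n)" and "\<And>i. 0 < c i" and "\<And>i. 1 \<le> r i"
  shows "(\<forall>f K arr. matching_cost r f \<and> balanced r K arr \<longrightarrow>
            (\<forall>\<alpha>>0. policy_cost c r f K arr (CB \<alpha> c r f)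
                     \<le> ereal (1 + max \<alpha> (1 / \<alpha>)) * opt_cost c r f K arr) \<and>
            policy_cost c r f K arr (CB 1 c r f) \<le> 2 * opt_cost c r f K arr) \<and>
         (\<forall>\<eta>>0. \<forall>\<pi>. (\<forall>f. matching_cost r f \<longrightarrow> online_policy r (\<pi> f)) \<longrightarrow>
            (\<exists>f K arr. matching_cost r f \<and> 0 < K \<and> balanced r K arr \<and>
               ereal (2 - \<eta>) \<le> policy_cost c r f K arr (\<pi> f) / opt_cost c r f K arr))"
proof (intro conjI allI impI)
  fix f K arr assume inst: "matching_cost r f \<and> balanced r K arr"
  show "policy_cost c r f K arr (CB \<alpha> c r f) \<le> ereal (1 + max \<alpha> (1 / \<alpha>)) * opt_cost c r f K arr"
    if "0 < \<alpha>" for \<alpha>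
    using CB_competitive[of \<alpha> c r f K arr] that assms inst by blast
  from this[of 1] show "policy_cost c r f K arr (CB 1 c r f) \<le> 2 * opt_cost c r f K arr"
    by simp
next
  fix \<eta> :: real and \<pi> :: "('n state \<Rightarrow> real) \<Rightarrow> 'n policy"
  assume "0 < \<eta>" "\<forall>f. matching_cost r f \<longrightarrow> online_policy r (\<pi> f)"
  then show "\<exists>f K arr. matching_cost r f \<and> 0 < K \<and> balanced r K arr \<and>
               ereal (2 - \<eta>) \<le> policy_cost c r f K arr (\<pi> f) / opt_cost c r f K arr"
    using no_policy_better_than_2[of c r \<eta> \<pi>] assms(2,3) by blast
qed

end
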